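(* (1) Let $\delta>0$. There exist a constant $c_\delta>0$ depending only on $\delta$ and an absolute constant $K>0$ such that for almost all $\alpha\in(0,1)$ with respect to Lebesgue measure, for all sufficiently small $\epsilon>0$ (in terms of $\alpha$), $$c_\delta\, \epsilon^{-1}(\log \epsilon^{-1})^{-2(1+\delta)} \leq \tau_{\epsilon}(\alpha) \leq K \epsilon^{-1}.$$ (2) An irrational $\alpha \in (0,1)$ has bounded partial quotients if and only if there exist constants $c_\alpha, K_\alpha>0$ depending only on $\alpha$ such that $c_\alpha\, \epsilon^{-1}\leq \tau_{\epsilon}(\alpha) \leq K_{\alpha}\, \epsilon^{-1}$ for all sufficiently small $\epsilon>0$ (in terms of $\alpha$).
   Context: $\|\cdot\|$ denotes the distance to the nearest integer, and $\tau_{\epsilon}(\alpha):=\min\{n\geq 1 : \| n \alpha \| < \epsilon\}$, with $n$ ranging over integers. An irrational $\alpha$ with continued fraction expansion $[a_0;a_1,a_2,\ldots]$ has bounded partial quotients if the $a_n$ are uniformly bounded for $n\ge 1$. In part (1), $\delta$ is fixed first, so the exceptional null set and the smallness threshold for $\epsilon$ may depend on it. *)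

theory Defs
  imports "HOL-Analysis.Analysis"
begin

definition dist_int :: "real \<Rightarrow> real" where
  "dist_int x = infdist x \<int>"

text \<open>For \<open>\<epsilon> > 0\<close> the minimum exists by Dirichlet's approximation theorem.\<close>

definition hit_time :: "real \<Rightarrow> real \<Rightarrow> nat" where
  "hit_time \<epsilon> \<alpha> = (LEAST n. 1 \<le> n \<and> dist_int (real n * \<alpha>) < \<epsilon>)"

text \<open>The expansion \<open>[a\<^sub>0; a\<^sub>1, a\<^sub>2, \<dots>]\<close> of an irrational \<open>x\<close> comes from the continued fraction
  algorithm: \<open>x\<^sub>0 = x\<close>, \<open>a\<^sub>n = \<lfloor>x\<^sub>n\<rfloor>\<close>, \<open>x\<^sub>n\<^sub>+\<^sub>1 = 1 / (x\<^sub>n - a\<^sub>n)\<close>. The divisor is never zero when \<open>x\<close> is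
  irrational; for rational \<open>x\<close> the functions below carry no meaning past the end of the expansion.\<close>

primrec complete_quotient :: "real \<Rightarrow> nat \<Rightarrow> real" where
  "complete_quotient x 0 = x"
| "complete_quotient x (Suc n) = 1 / (complete_quotient x n - of_int \<lfloor>complete_quotient x n\<rfloor>)"

definition partial_quotient :: "real \<Rightarrow> nat \<Rightarrow> int" where
  "partial_quotient x n = \<lfloor>complete_quotient x n\<rfloor>"

definition bounded_partial_quotients :: "real \<Rightarrow> bool" where
  "bounded_partial_quotients x \<longleftrightarrow> (\<exists>B. \<forall>n\<ge>1. partial_quotient x n \<le> B)"

end

theory Submission
  imports Defs "HOL-Analysis.Kronecker_Approximation_Theorem"
begin

text \<open>
  Dirichlet's theorem gives the upper bounds. A lower bound on \<open>\<parallel>n \<alpha>\<parallel>\<close> at \<open>n = \<tau>\<^sub>\<epsilon>(\<alpha>)\<close>, where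
  \<open>\<parallel>n \<alpha>\<parallel> < \<epsilon>\<close>, becomes a lower bound on \<open>\<tau>\<^sub>\<epsilon>(\<alpha>)\<close>. In the metric statement the set
  where \<open>\<parallel>n \<alpha>\<parallel> < r\<close> has measure at most \<open>4 r\<close>, so by Borel--Cantelli almost every \<open>\<alpha>\<close> satisfies
  \<open>\<parallel>n \<alpha>\<parallel> \<ge> 1 / (n (1 + log n)\<^sup>2)\<close> for all large \<open>n\<close>; exponent \<open>2\<close> already serves every \<open>\<delta>\<close>.
  In the second statement the lower bound amounts to \<open>n \<parallel>n \<alpha>\<parallel>\<close> being bounded away from \<open>0\<close>. The
  convergents are the best approximations and \<open>q\<^sub>k \<parallel>q\<^sub>k \<alpha>\<parallel>\<close> is comparable to the inverse of the
  next complete quotient, which makes this equivalent to bounded partial quotients.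
\<close>

section \<open>Distance to the nearest integer and hitting times\<close>

lemma dist_int_le: "dist_int x \<le> \<bar>x - of_int k\<bar>"
  unfolding dist_int_def using infdist_le[of "of_int k" \<int> x] by (simp add: dist_real_def)

lemma dist_int_attained: obtains k where "dist_int x = \<bar>x - of_int k\<bar>"
proof -
  obtain y where "y \<in> (\<int> :: real set)" "infdist x \<int> = dist x y"
    using infdist_attains_inf[of "\<int> :: real set" x] Ints_0 by (metis closed_Ints empty_iff)
  then show ?thesis
    using that by (auto simp: dist_int_def dist_real_def elim!: Ints_cases)
qed

lemma continuous_on_dist_int: "continuous_on S dist_int"
  unfolding dist_int_def[abs_def] by (intro continuous_intros)

lemma dist_int_multiple_pos:
  assumes "\<alpha> \<notin> \<rat>" "n \<ge> 1"
  shows "0 < dist_int (real n * \<alpha>)"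
proof -
  obtain k where k: "dist_int (real n * \<alpha>) = \<bar>real n * \<alpha> - of_int k\<bar>"
    by (rule dist_int_attained)
  have "real n * \<alpha> \<noteq> of_int k"
  proof
    assume "real n * \<alpha> = of_int k"
    then have "\<alpha> = of_int k / of_nat n" using assms by (simp add: field_simps)
    then show False using assms(1) by simp
  qed
  then show ?thesis using k by simp
qed

lemma hit_time_exists:
  assumes "N > 0"
  shows "\<exists>n\<ge>1. n \<le> N \<and> dist_int (real n * \<alpha>) < 1 / real N"
proof -
  obtain h k where hk: "0 < k" "k \<le> int N" "\<bar>of_int k * \<alpha> - of_int h\<bar> < 1 / N"
    using Dirichlet_approx[OF assms] by blast
  have "dist_int (real (nat k) * \<alpha>) < 1 / N"
    using dist_int_le[of "real (nat k) * \<alpha>" h] hk by simp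
  then show ?thesis using hk by (intro exI[of _ "nat k"]) auto
qed

lemma hit_time_le:
  assumes "1 \<le> n" "dist_int (real n * \<alpha>) < \<epsilon>"
  shows "hit_time \<epsilon> \<alpha> \<le> n"
  unfolding hit_time_def using assms by (intro Least_le) simp

text \<open>Dirichlet's theorem with \<open>N\<close> the ceiling of 1/\<epsilon> gives a witness n
  \<le> N < 1/\<epsilon> + 1, because 1/N \<le> \<epsilon>. Its existence gives the
  \<open>LEAST\<close> in \<open>hit_time\<close> the intended value.\<close>

lemma hit_time_properties:
  assumes "\<epsilon> > 0"
  shows hit_time_ge_1: "1 \<le> hit_time \<epsilon> \<alpha>"
    and dist_int_hit_time: "dist_int (real (hit_time \<epsilon> \<alpha>) * \<alpha>) < \<epsilon>"
    and hit_time_le_ceiling: "real (hit_time \<epsilon> \<alpha>) \<le> inverse \<epsilon> + 1"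
proof -
  define N where "N = nat \<lceil>inverse \<epsilon>\<rceil>"
  have N: "N > 0" "inverse \<epsilon> \<le> N" "N < inverse \<epsilon> + 1"
    using assms unfolding N_def by (auto simp: le_of_int_ceiling) linarith+
  have "1 / N \<le> \<epsilon>" using N assms by (simp add: field_simps)
  then obtain n where n: "1 \<le> n" "n \<le> N" "dist_int (real n * \<alpha>) < \<epsilon>"
    using hit_time_exists[OF N(1), of \<alpha>] by fastforce
  show "1 \<le> hit_time \<epsilon> \<alpha>" "dist_int (real (hit_time \<epsilon> \<alpha>) * \<alpha>) < \<epsilon>"
    using LeastI[of "\<lambda>n. 1 \<le> n \<and> dist_int (real n * \<alpha>) < \<epsilon>" n] n unfolding hit_time_def by auto
  show "real (hit_time \<epsilon> \<alpha>) \<le> inverse \<epsilon> + 1"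
    using hit_time_le[OF n(1,3)] n(2) N(3) by linarith
qed

lemma hit_time_upper:
  assumes "0 < \<epsilon>" "\<epsilon> \<le> 1"
  shows "real (hit_time \<epsilon> \<alpha>) \<le> 2 * inverse \<epsilon>"
  using hit_time_le_ceiling[OF assms(1), of \<alpha>] one_le_inverse[OF assms] by linarith

text \<open>Irrationality makes the finitely many distances with 1 \<le> n < N positive, and an
  \<epsilon> below all of them excludes these n. Facts about all large n thereby apply at the
  hitting time for all small \<epsilon>.\<close>

lemma eventually_hit_time_ge:
  assumes "\<alpha> \<notin> \<rat>"
  shows "\<forall>\<^sub>F \<epsilon> in at_right 0. N \<le> hit_time \<epsilon> \<alpha>"
proof -
  have "\<forall>\<^sub>F \<epsilon> in at_right 0. \<forall>n\<in>{1..<N}. \<epsilon> < dist_int (real n * \<alpha>)"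
    by (rule eventually_ball_finite)
      (auto intro!: eventually_at_right_less order_tendstoD(2)[OF tendsto_ident_at]
        dist_int_multiple_pos[OF assms])
  then show ?thesis
    using eventually_at_right_less[of 0]
  proof eventually_elim
    case (elim \<epsilon>)
    show ?case
      using elim(1) hit_time_ge_1[OF elim(2), of \<alpha>] dist_int_hit_time[OF elim(2), of \<alpha>]
      by (metis atLeastLessThan_iff not_le order.asym)
  qed
qed

section \<open>The metric statement\<close>

text \<open>Cauchy condensation reduces this to the sum of 1/(1 + n ln 2)^2, which a multiple of
  1/n^2 dominates.\<close>

lemma summable_inverse_n_log_squared:
  "summable (\<lambda>n. 1 / (real n * (1 + ln (real n))\<^sup>2))"
proof -
  let ?f = "\<lambda>n::nat. 1 / (real n * (1 + ln (real n))\<^sup>2)"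
  have "summable ?f \<longleftrightarrow> summable (\<lambda>n. 2 ^ n * ?f (2 ^ n))"
  proof (rule condensation_test)
    fix m :: nat assume m: "0 < m"
    then have "0 \<le> ln (real m)" "ln (real m) \<le> ln (real (Suc m))" by auto
    then have "real m * (1 + ln (real m))\<^sup>2 \<le> real (Suc m) * (1 + ln (real (Suc m)))\<^sup>2"
      by (intro mult_mono power_mono) auto
    moreover have "0 < real m * (1 + ln (real m))\<^sup>2"
      using m \<open>0 \<le> ln (real m)\<close> by (intro mult_pos_pos zero_less_power add_pos_nonneg) auto
    ultimately show "?f (Suc m) \<le> ?f m" by (intro divide_left_mono) auto
  qed simp
  moreover have "summable (\<lambda>n. 2 ^ n * ?f (2 ^ n))"
  proof (rule summable_comparison_test')
    have "summable (\<lambda>n. inverse (real n ^ 2))" by (rule inverse_power_summable) simp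
    then show "summable (\<lambda>n. inverse ((ln 2)\<^sup>2) * inverse (real n ^ 2))"
      by (rule summable_mult)
    fix n :: nat assume n: "1 \<le> n"
    have "2 ^ n * ?f (2 ^ n) = 1 / (1 + real n * ln 2)\<^sup>2" by (simp add: ln_realpow)
    also have "\<dots> \<le> 1 / (real n * ln 2)\<^sup>2"
      using n by (intro divide_left_mono power_mono mult_pos_pos zero_less_power) (auto intro: add_pos_nonneg)
    finally show "norm (2 ^ n * ?f (2 ^ n)) \<le> inverse ((ln 2)\<^sup>2) * inverse (real n ^ 2)"
      by (simp add: field_simps)
  qed
  ultimately show ?thesis by simp
qed

lemma lmeasurable_dist_int_less: "{\<alpha> \<in> {0<..<1}. dist_int (real n * \<alpha>) < r} \<in> lmeasurable"
proof (rule lmeasurable_open)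
  have "open {\<alpha>. dist_int (real n * \<alpha>) < r}"
    by (intro open_Collect_less continuous_on_compose2[OF continuous_on_dist_int[of UNIV]]
        continuous_intros) auto
  then have "open ({0<..<1} \<inter> {\<alpha>. dist_int (real n * \<alpha>) < r})" by (intro open_Int) auto
  then show "open {\<alpha> \<in> {0<..<1}. dist_int (real n * \<alpha>) < r}" by (simp add: Int_def)
  show "bounded {\<alpha> \<in> {0<..<1}. dist_int (real n * \<alpha>) < r}"
    by (rule bounded_subset[OF bounded_box[of 0 1]]) (auto simp: box_real)
qed

text \<open>The n + 1 intervals of radius r/n around k/n, 0 \<le> k \<le> n, cover the set; their
  total length is 2r(n + 1)/n \<le> 4r.\<close>

lemma measure_dist_int_less:
  assumes n: "n \<ge> 1" and r: "0 \<le> r" "r \<le> 1"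
  shows "measure lebesgue {\<alpha> \<in> {0<..<1}. dist_int (real n * \<alpha>) < r} \<le> 4 * r"
proof -
  let ?A = "{\<alpha> \<in> {0<..<1}. dist_int (real n * \<alpha>) < r}"
  let ?I = "\<lambda>k. {(real k - r) / n .. (real k + r) / n}"
  have sub: "?A \<subseteq> (\<Union>k\<in>{..n}. ?I k)"
  proof
    fix \<alpha> assume A: "\<alpha> \<in> ?A"
    obtain k where k: "dist_int (real n * \<alpha>) = \<bar>real n * \<alpha> - of_int k\<bar>"
      by (rule dist_int_attained)
    have "0 < real n * \<alpha>" "real n * \<alpha> < n" using A n by auto
    \<comment> \<open>Here r \<le> 1 enters: it keeps the nearest integer within 0..n.\<close>
    then have "-1 < (of_int k :: real)" "of_int k < real n + 1" using k A r by auto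
    then have "nat k \<le> n" "real (nat k) = of_int k" by linarith+
    moreover have "\<alpha> \<in> ?I (nat k)"
      using \<open>real (nat k) = of_int k\<close> k A n by (auto simp: field_simps abs_less_iff)
    ultimately show "\<alpha> \<in> (\<Union>k\<in>{..n}. ?I k)" by blast
  qed
  have "measure lebesgue ?A \<le> measure lebesgue (\<Union>k\<in>{..n}. ?I k)"
    by (rule measure_mono_fmeasurable[OF sub fmeasurableD[OF lmeasurable_dist_int_less]
          fmeasurable.finite_UN]) auto
  also have "\<dots> \<le> (\<Sum>k\<in>{..n}. measure lebesgue (?I k))"
    by (rule measure_UNION_le) auto
  also have "\<dots> = (\<Sum>k\<in>{..n}. 2 * r / n)"
    using r n by (intro sum.cong refl) (auto simp: field_simps)
  also have "\<dots> = (2 * r) * ((real n + 1) / n)" by simp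
  also have "\<dots> \<le> (2 * r) * 2"
    using n r by (intro mult_left_mono) (auto simp: field_simps)
  finally show ?thesis by simp
qed

lemma AE_dist_int_ge:
  "AE \<alpha>\<in>{0<..<1} in lebesgue. \<forall>\<^sub>F n in sequentially.
     1 / (real n * (1 + ln (real n))\<^sup>2) \<le> dist_int (real n * \<alpha>)"
proof -
  let ?f = "\<lambda>n::nat. 1 / (real n * (1 + ln (real n))\<^sup>2)"
  define A where "A n = {\<alpha> \<in> {0<..<1}. dist_int (real n * \<alpha>) < ?f n}" for n
  have A: "A n \<in> lmeasurable" for n
    unfolding A_def by (rule lmeasurable_dist_int_less)
  have bound: "norm (measure lebesgue (A n)) \<le> 4 * ?f n" if n: "n \<ge> 1" for n
  proof -
    \<comment> \<open>The measure estimate asks for a radius of at most 1.\<close>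
    have "1 * 1 \<le> real n * (1 + ln (real n))\<^sup>2"
      using n by (intro mult_mono one_le_power) auto
    then have "?f n \<le> 1" by (simp add: divide_le_eq_1)
    moreover have "0 \<le> ?f n" by simp
    ultimately have "measure lebesgue (A n) \<le> 4 * ?f n"
      unfolding A_def by (intro measure_dist_int_less[OF n])
    then show ?thesis by (simp only: real_norm_def abs_of_nonneg measure_nonneg)
  qed
  have "AE \<alpha> in lebesgue. \<forall>\<^sub>F n in sequentially. \<alpha> \<in> space lebesgue - A n"
  proof (rule borel_cantelli_AE1)
    show "A n \<in> sets lebesgue" for n using A by (rule fmeasurableD)
    show "emeasure lebesgue (A n) < \<infinity>" for n
      using A[of n] by (simp only: fmeasurable_def mem_Collect_eq)
    show "summable (\<lambda>n. measure lebesgue (A n))"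
    proof (rule summable_comparison_test')
      show "summable (\<lambda>n. 4 * ?f n)" by (rule summable_mult[OF summable_inverse_n_log_squared])
    qed (rule bound)
  qed
  then show ?thesis
  proof eventually_elim
    case (elim \<alpha>)
    show ?case
    proof
      assume \<alpha>: "\<alpha> \<in> {0<..<1}"
      show "\<forall>\<^sub>F n in sequentially. ?f n \<le> dist_int (real n * \<alpha>)"
        using elim by (rule eventually_mono) (use \<alpha> in \<open>simp add: A_def not_less\<close>)
    qed
  qed
qed

text \<open>Rational \<alpha> have to be discarded: their hitting times stay bounded as \<epsilon>
  tends to 0.\<close>

lemma AE_irrational: "AE \<alpha> in lebesgue. (\<alpha>::real) \<notin> \<rat>"
  using null_sets_completionI[OF countable_imp_null_set_lborel[OF countable_rat]]
  by (rule AE_not_in)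

text \<open>At the hitting time the assumed bound lies below \<epsilon>, so n > (1/\<epsilon>) / (1
  + ln n)^2. The a priori bound n \<le> 2/\<epsilon> gives 1 + ln n \<le> 3 ln(1/\<epsilon>), and
  squaring the 3 yields the constant 1/9.\<close>

lemma hit_time_lower_of_dist_int_ge:
  assumes \<epsilon>: "0 < \<epsilon>" "\<epsilon> \<le> exp (-1)" and \<delta>: "\<delta> > 0"
    and ge: "1 / (real n * (1 + ln (real n))\<^sup>2) \<le> dist_int (real n * \<alpha>)"
    and n: "n = hit_time \<epsilon> \<alpha>"
  shows "1/9 * inverse \<epsilon> * ln (inverse \<epsilon>) powr (- 2 * (1 + \<delta>)) \<le> real n"
proof -
  define L where "L = ln (inverse \<epsilon>)"
  \<comment> \<open>For \<epsilon> \<le> 1/e one has \<open>L\<close> \<ge> 1, which absorbs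
    additive constants into 3L and makes powers of \<open>L\<close> monotone in the
    exponent.\<close>
  have "ln \<epsilon> \<le> -1" using \<epsilon> by (metis exp_gt_zero ln_exp ln_mono)
  then have L: "1 \<le> L" using \<epsilon> by (simp add: L_def ln_inverse)
  have "exp (-1) \<le> (1::real)" by simp
  then have "\<epsilon> \<le> 1" using \<epsilon>(2) by linarith
  then have up: "real n \<le> 2 * inverse \<epsilon>" using hit_time_upper \<epsilon>(1) n by simp
  have n1: "1 \<le> n" using hit_time_ge_1 \<epsilon> n by simp
  have "ln (real n) \<le> ln (2 * inverse \<epsilon>)" using up n1 by (intro ln_mono) auto
  also have "\<dots> = ln 2 + L" using \<epsilon> by (simp add: L_def ln_mult)
  also have "\<dots> \<le> 1 + L" using ln_2_less_1 by simp
  finally have "1 + ln (real n) \<le> 3 * L" using L by simp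
  moreover have pos: "0 < 1 + ln (real n)" using n1 by (simp add: add_pos_nonneg)
  ultimately have sq: "(1 + ln (real n))\<^sup>2 \<le> 9 * L\<^sup>2"
    using power_mono[of "1 + ln (real n)" "3 * L" 2] by (simp add: power_mult_distrib)
  have "1 / (real n * (1 + ln (real n))\<^sup>2) < \<epsilon>"
    using ge dist_int_hit_time[OF \<epsilon>(1), of \<alpha>] n by simp
  then have "inverse \<epsilon> < real n * (1 + ln (real n))\<^sup>2"
    using \<epsilon> n1 pos by (simp add: field_simps)
  also have "\<dots> \<le> real n * (9 * L\<^sup>2)" using sq by (intro mult_left_mono) auto
  finally have "inverse \<epsilon> \<le> real n * (9 * L\<^sup>2)" by simp
  then have 1: "1/9 * inverse \<epsilon> * inverse (L\<^sup>2) \<le> real n"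
    using L \<epsilon>(1) by (simp add: divide_simps mult_ac)
  \<comment> \<open>The bound with exponent -2 implies the one with -2(1 + \<delta>), with the same
    constant.\<close>
  have "L powr (- 2 * (1 + \<delta>)) \<le> L powr (-2)" using L \<delta> by (intro powr_mono) auto
  also have "\<dots> = inverse (L\<^sup>2)" using L by (simp add: powr_minus powr_numeral)
  finally have "1/9 * inverse \<epsilon> * L powr (- 2 * (1 + \<delta>)) \<le> 1/9 * inverse \<epsilon> * inverse (L\<^sup>2)"
    using \<epsilon> by (intro mult_left_mono) auto
  then show ?thesis using 1 by (simp add: L_def)
qed

lemma AE_hit_time_bounds:
  assumes \<delta>: "\<delta> > 0"
  shows "AE \<alpha>\<in>{0<..<1} in lebesgue. \<forall>\<^sub>F \<epsilon> in at_right 0.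
     1/9 * inverse \<epsilon> * ln (inverse \<epsilon>) powr (- 2 * (1 + \<delta>)) \<le> real (hit_time \<epsilon> \<alpha>) \<and>
     real (hit_time \<epsilon> \<alpha>) \<le> 2 * inverse \<epsilon>"
  using AE_dist_int_ge AE_irrational
proof eventually_elim
  case (elim \<alpha>)
  show ?case
  proof
    assume "\<alpha> \<in> {0<..<1}"
    then obtain N where N: "\<And>n. n \<ge> N \<Longrightarrow>
        1 / (real n * (1 + ln (real n))\<^sup>2) \<le> dist_int (real n * \<alpha>)"
      using elim(1) by (auto simp: eventually_sequentially)
    have "\<forall>\<^sub>F \<epsilon> in at_right 0. \<epsilon> < exp (-1 :: real)"
      by (rule order_tendstoD(2)[OF tendsto_ident_at]) simp
    then show "\<forall>\<^sub>F \<epsilon> in at_right 0.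
        1/9 * inverse \<epsilon> * ln (inverse \<epsilon>) powr (- 2 * (1 + \<delta>)) \<le> real (hit_time \<epsilon> \<alpha>) \<and>
        real (hit_time \<epsilon> \<alpha>) \<le> 2 * inverse \<epsilon>"
      using eventually_hit_time_ge[OF elim(2), of N] eventually_at_right_less[of 0]
    proof eventually_elim
      case (elim \<epsilon>)
      have "exp (-1) \<le> (1::real)" by simp
      then have "\<epsilon> \<le> 1" using elim(1) by linarith
      then show ?case
        using hit_time_lower_of_dist_int_ge[OF elim(3) _ \<delta> N[OF elim(2)] refl]
          hit_time_upper[OF elim(3)] elim(1) by simp
    qed
  qed
qed

section \<open>Badly approximable numbers\<close>

text \<open>Forwards, the lower bound is tested at \<epsilon> = 2 ||n\<alpha>||, where n itself is a
  hit; backwards, n ||n\<alpha>|| is evaluated at the hitting time.\<close>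

lemma hit_time_bounds_iff_badly_approximable:
  assumes irr: "\<alpha> \<notin> \<rat>"
  shows "(\<exists>c K::real. c > 0 \<and> K > 0 \<and> (\<forall>\<^sub>F \<epsilon> in at_right 0.
            c * inverse \<epsilon> \<le> real (hit_time \<epsilon> \<alpha>) \<and> real (hit_time \<epsilon> \<alpha>) \<le> K * inverse \<epsilon>))
     \<longleftrightarrow> (\<exists>c>0. \<forall>n\<ge>1. c \<le> real n * dist_int (real n * \<alpha>))"
    (is "?L \<longleftrightarrow> ?R")
proof
  assume ?L
  then obtain c b where c: "c > 0" and b: "b > 0"
    and low: "\<And>\<epsilon>. 0 < \<epsilon> \<Longrightarrow> \<epsilon> < b \<Longrightarrow> c * inverse \<epsilon> \<le> real (hit_time \<epsilon> \<alpha>)"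
    unfolding eventually_at_right_field by auto
  \<comment> \<open>The value c/2 serves the case where 2d lies in the range (0, b) of the
    hypothesis, b/2 the case d \<ge> b/2.\<close>
  have "min (c / 2) (b / 2) \<le> real n * dist_int (real n * \<alpha>)" if n: "n \<ge> 1" for n
  proof -
    define d where "d = dist_int (real n * \<alpha>)"
    have d: "0 < d" unfolding d_def using dist_int_multiple_pos irr n by blast
    show ?thesis
    proof (cases "2 * d < b")
      case True
      \<comment> \<open>Doubling d makes the strict hitting condition hold at n.\<close>
      have "c * inverse (2 * d) \<le> real (hit_time (2 * d) \<alpha>)" using True d by (intro low) auto
      also have "\<dots> \<le> real n"
        using hit_time_le[OF n, of \<alpha> "2 * d"] d by (simp add: d_def)
      finally have "c / 2 \<le> real n * d" using d by (simp add: field_simps)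
      then show ?thesis by (simp add: d_def)
    next
      case False
      have "1 * d \<le> real n * d" using n d by (intro mult_right_mono) auto
      then show ?thesis using False by (simp add: d_def)
    qed
  qed
  then show ?R using c b by (intro exI[of _ "min (c / 2) (b / 2)"]) auto
next
  assume ?R
  then obtain c where c: "c > 0" "\<And>n. n \<ge> 1 \<Longrightarrow> c \<le> real n * dist_int (real n * \<alpha>)" by blast
  have "\<forall>\<^sub>F \<epsilon> in at_right 0. \<epsilon> < (1 :: real)"
    by (rule order_tendstoD(2)[OF tendsto_ident_at]) simp
  then have "\<forall>\<^sub>F \<epsilon> in at_right 0. c * inverse \<epsilon> \<le> real (hit_time \<epsilon> \<alpha>) \<and>
      real (hit_time \<epsilon> \<alpha>) \<le> 2 * inverse \<epsilon>"
    using eventually_at_right_less[of 0]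
  proof eventually_elim
    case (elim \<epsilon>)
    let ?n = "hit_time \<epsilon> \<alpha>"
    have "c \<le> real ?n * dist_int (real ?n * \<alpha>)" using c(2) hit_time_ge_1 elim by blast
    also have "\<dots> \<le> real ?n * \<epsilon>"
      using dist_int_hit_time[OF elim(2), of \<alpha>] by (intro mult_left_mono) auto
    finally show ?case using elim hit_time_upper[of \<epsilon> \<alpha>] by (simp add: field_simps)
  qed
  then show ?L using c(1) by (intro exI[of _ c] exI[of _ 2]) auto
qed

section \<open>Convergents\<close>

text \<open>The index is shifted by one: \<open>convergent_num x (n + 1) / convergent_den x (n + 1)\<close> is the
  convergent \<open>[a\<^sub>0; a\<^sub>1, \<dots>, a\<^sub>n]\<close>.\<close>

fun convergent_num :: "real \<Rightarrow> nat \<Rightarrow> int" where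
  "convergent_num x 0 = 1"
| "convergent_num x (Suc 0) = partial_quotient x 0"
| "convergent_num x (Suc (Suc n)) =
     partial_quotient x (Suc n) * convergent_num x (Suc n) + convergent_num x n"

fun convergent_den :: "real \<Rightarrow> nat \<Rightarrow> int" where
  "convergent_den x 0 = 0"
| "convergent_den x (Suc 0) = 1"
| "convergent_den x (Suc (Suc n)) =
     partial_quotient x (Suc n) * convergent_den x (Suc n) + convergent_den x n"

text \<open>The sign is kept because consecutive errors alternate; index 0 gives -1.\<close>

definition convergent_err :: "real \<Rightarrow> nat \<Rightarrow> real" where
  "convergent_err x n = of_int (convergent_den x n) * x - of_int (convergent_num x n)"

text \<open>A recursion step adds a multiple of the newer column to the older one and swaps them, so
  the determinant just changes sign. Consecutive pairs thus form a basis of the integer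
  lattice.\<close>

lemma convergent_det:
  "convergent_num x (Suc n) * convergent_den x n - convergent_num x n * convergent_den x (Suc n)
     = (-1) ^ Suc n"
  by (induction n) (auto simp: algebra_simps)

context
  fixes x :: real
  assumes irrational: "x \<notin> \<rat>"
begin

private abbreviation (input) a where "a \<equiv> partial_quotient x"
private abbreviation (input) X where "X \<equiv> complete_quotient x"
private abbreviation (input) P where "P \<equiv> convergent_num x"
private abbreviation (input) Q where "Q \<equiv> convergent_den x"
private abbreviation (input) D where "D \<equiv> convergent_err x"

lemma complete_quotient_irrational: "X n \<notin> \<rat>"
proof (induction n)
  case (Suc n)
  show ?case
  proof
    assume "X (Suc n) \<in> \<rat>"
    then have "inverse (X (Suc n)) + of_int \<lfloor>X n\<rfloor> \<in> \<rat>" by (intro Rats_add Rats_inverse) auto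
    then show False using Suc.IH by (simp add: inverse_eq_divide)
  qed
qed (simp add: irrational)

lemma complete_quotient_Suc_gt_1: "1 < X (Suc n)"
proof -
  have "X n \<noteq> of_int \<lfloor>X n\<rfloor>" using complete_quotient_irrational[of n] by (metis Rats_of_int)
  then have "0 < X n - of_int \<lfloor>X n\<rfloor>" "X n - of_int \<lfloor>X n\<rfloor> < 1" by linarith+
  then show ?thesis by (simp add: less_divide_eq)
qed

lemma partial_quotient_Suc_ge_1: "1 \<le> a (Suc n)"
  using complete_quotient_Suc_gt_1[of n] unfolding partial_quotient_def by linarith

lemma complete_quotient_less: "X n < of_int (a n) + 1"
  unfolding partial_quotient_def by linarith

lemma partial_quotient_le: "of_int (a n) \<le> X n"
  unfolding partial_quotient_def by linarith

lemma complete_quotient_step: "(X n - of_int (a n)) * X (Suc n) = 1"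
  using complete_quotient_Suc_gt_1[of n] unfolding partial_quotient_def
  by (auto simp: divide_simps split: if_splits)

text \<open>Positivity feeds monotonicity in the induction. Growth may be weak: \<open>Q 1\<close>
  equals \<open>Q 2\<close> when \<open>a 1\<close> is 1.\<close>

lemma convergent_den_mono: "0 \<le> Q n \<and> 1 \<le> Q (Suc n) \<and> Q n \<le> Q (Suc n)"
proof (induction n)
  case (Suc n)
  have "1 * Q (Suc n) \<le> a (Suc n) * Q (Suc n)"
    using Suc partial_quotient_Suc_ge_1[of n] by (intro mult_right_mono) auto
  then show ?case using Suc by (simp only: convergent_den.simps) linarith
qed simp

text \<open>Linear growth suffices to place every q \<ge> 1 between two consecutive
  denominators.\<close>

lemma convergent_den_ge: "int n \<le> Q (Suc n)"
proof (induction n)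
  case (Suc n)
  have "1 * Q (Suc n) \<le> a (Suc n) * Q (Suc n)"
    using convergent_den_mono[of n] partial_quotient_Suc_ge_1[of n] by (intro mult_right_mono) auto
  \<comment> \<open>For n = 0 the summand \<open>Q 0\<close> vanishes, but there the claim is just
    \<open>Q 2\<close> \<ge> 1.\<close>
  moreover have "n \<ge> 1 \<Longrightarrow> 1 \<le> Q n" using convergent_den_mono[of "n - 1"] by simp
  ultimately show ?case
    using Suc convergent_den_mono[of n] unfolding convergent_den.simps
    by (cases "n = 0") linarith+
qed simp

text \<open>Minus the ratio of consecutive errors obeys the recursion of the complete quotients. As
  these exceed 1, the errors alternate in sign and shrink.\<close>

lemma convergent_err_step: "D (Suc n) * X (Suc n) = - D n"
proof (induction n)
  case 0
  show ?case
    using complete_quotient_step[of 0] by (simp add: convergent_err_def)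
next
  case (Suc n)
  have "D (Suc (Suc n)) = of_int (a (Suc n)) * D (Suc n) + D n"
    by (simp add: convergent_err_def algebra_simps)
  also have "\<dots> = - D (Suc n) * (X (Suc n) - of_int (a (Suc n)))"
    using Suc by (simp add: algebra_simps)
  finally have "D (Suc (Suc n)) * X (Suc (Suc n)) =
      - D (Suc n) * ((X (Suc n) - of_int (a (Suc n))) * X (Suc (Suc n)))" by simp
  then show ?case by (simp only: complete_quotient_step)
qed

text \<open>Replacing \<open>D (Suc n) * X (Suc n)\<close> by \<open>- D n\<close> leaves the
  determinant up to sign. This is the classical error formula in terms of the complete
  quotient.\<close>

lemma convergent_err_mult:
  "\<bar>D (Suc n)\<bar> * (of_int (Q (Suc n)) * X (Suc n) + of_int (Q n)) = 1"
proof -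
  have det: "of_int (P (Suc n)) * of_int (Q n) - of_int (P n) * of_int (Q (Suc n))
      = (-1 :: real) ^ Suc n"
    using arg_cong[OF convergent_det[of x n], of "of_int :: int \<Rightarrow> real"] by simp
  have "D (Suc n) * (of_int (Q (Suc n)) * X (Suc n) + of_int (Q n))
      = of_int (Q (Suc n)) * (D (Suc n) * X (Suc n)) + of_int (Q n) * D (Suc n)"
    by (simp add: algebra_simps)
  also have "\<dots> = - (of_int (P (Suc n)) * of_int (Q n) - of_int (P n) * of_int (Q (Suc n)))"
    unfolding convergent_err_step by (simp add: convergent_err_def algebra_simps)
  also have "\<dots> = (-1) ^ n" unfolding det by simp
  finally have "\<bar>D (Suc n) * (of_int (Q (Suc n)) * X (Suc n) + of_int (Q n))\<bar> = 1"
    by (simp add: power_abs)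
  moreover have "0 \<le> of_int (Q (Suc n)) * X (Suc n) + of_int (Q n)"
    using convergent_den_mono[of n] complete_quotient_Suc_gt_1[of n] by simp
  ultimately show ?thesis by (simp add: abs_mult)
qed

text \<open>Writing \<open>(q, p)\<close> as an integer combination of two consecutive convergents, the coefficients
  have opposite signs, as have the two errors, so no cancellation occurs.\<close>

lemma convergent_best_approximation:
  assumes q: "0 < q" "q < Q (Suc n)"
  shows "\<bar>D n\<bar> \<le> \<bar>of_int q * x - of_int p\<bar>"
proof -
  define s :: int where "s = (-1) ^ Suc n"
  \<comment> \<open>Cramer's rule for the coefficients of (q, p); the determinant \<open>s\<close>
    is its own inverse, so multiplication replaces division.\<close>
  define u where "u = s * (q * P (Suc n) - p * Q (Suc n))"
  define v where "v = s * (p * Q n - q * P n)"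
  have ss: "s * s = 1" unfolding s_def by (simp flip: power_mult_distrib)
  have det: "P (Suc n) * Q n - P n * Q (Suc n) = s" unfolding s_def by (rule convergent_det)
  have "u * Q n + v * Q (Suc n) = s * (P (Suc n) * Q n - P n * Q (Suc n)) * q"
    by (simp add: u_def v_def algebra_simps)
  then have uvq: "u * Q n + v * Q (Suc n) = q" using det ss by simp
  have "u * P n + v * P (Suc n) = s * (P (Suc n) * Q n - P n * Q (Suc n)) * p"
    by (simp add: u_def v_def algebra_simps)
  then have uvp: "u * P n + v * P (Suc n) = p" using det ss by simp
  have err: "of_int q * x - of_int p = of_int u * D n + of_int v * D (Suc n)"
    by (simp add: uvq[symmetric] uvp[symmetric] convergent_err_def algebra_simps)
  have Q: "0 \<le> Q n" "1 \<le> Q (Suc n)" using convergent_den_mono[of n] by auto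
  have large: "Q (Suc n) \<le> w * Q (Suc n)" if "1 \<le> w" for w
    using mult_right_mono[of 1 w "Q (Suc n)"] that Q by simp
  \<comment> \<open>Otherwise q would be a multiple of \<open>Q (Suc n)\<close>, against 0 < q <
    \<open>Q (Suc n)\<close>.\<close>
  have "u \<noteq> 0"
    using uvq q Q large[of v] mult_nonpos_nonneg[of v "Q (Suc n)"] by (cases "1 \<le> v") force+
  \<comment> \<open>Equal strict signs would force q \<ge> \<open>Q (Suc n)\<close> or q \<le>
    0.\<close>
  have opp: "u * v \<le> 0"
  proof (rule ccontr)
    assume "\<not> u * v \<le> 0"
    then consider "u > 0" "v > 0" | "u < 0" "v < 0" by (auto simp: not_le zero_less_mult_iff)
    then show False
    proof cases
      case 1
      then show False using large[of v] uvq q Q mult_nonneg_nonneg[of u "Q n"] by linarith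
    next
      case 2
      then show False
        using uvq q Q mult_nonpos_nonneg[of u "Q n"] mult_nonpos_nonneg[of v "Q (Suc n)"] by linarith
    qed
  qed
  have "D n = - (D (Suc n) * X (Suc n))" using convergent_err_step[of n] by simp
  then have "(of_int u * D n) * (of_int v * D (Suc n))
      = - of_int (u * v) * ((D (Suc n))\<^sup>2 * X (Suc n))"
    by (simp add: power2_eq_square)
  also have "\<dots> \<ge> 0"
    using opp complete_quotient_Suc_gt_1[of n]
    by (intro mult_nonneg_nonneg) (auto simp flip: of_int_mult)
  finally have "\<bar>of_int u * D n + of_int v * D (Suc n)\<bar>
      = \<bar>of_int u * D n\<bar> + \<bar>of_int v * D (Suc n)\<bar>"
    by (auto simp: zero_le_mult_iff)
  then have "\<bar>of_int q * x - of_int p\<bar> \<ge> \<bar>of_int u * D n\<bar>" unfolding err by simp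
  moreover have "1 \<le> \<bar>of_int u :: real\<bar>" using \<open>u \<noteq> 0\<close> by linarith
  ultimately show ?thesis
    using mult_right_mono[of 1 "\<bar>of_int u :: real\<bar>" "\<bar>D n\<bar>"] by (simp add: abs_mult)
qed

text \<open>Both directions rest on \<open>convergent_err_mult\<close>. Best approximation compares
  any q with the last denominator not exceeding it; conversely, testing at the denominators bounds
  the complete quotients by 1/c.\<close>

lemma bounded_partial_quotients_iff_badly_approximable:
  "bounded_partial_quotients x \<longleftrightarrow> (\<exists>c>0. \<forall>n\<ge>1. c \<le> real n * dist_int (real n * x))"
    (is "?L \<longleftrightarrow> ?R")
proof
  assume ?L
  then obtain B where B: "\<And>n. n \<ge> 1 \<Longrightarrow> a n \<le> B"
    unfolding bounded_partial_quotients_def by blast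
  have B1: "1 \<le> B" using partial_quotient_Suc_ge_1[of 0] B[of 1] by simp
  have "1 / (of_int B + 2) \<le> real q * dist_int (real q * x)" if q: "q \<ge> 1" for q
  proof -
    obtain p where p: "dist_int (real q * x) = \<bar>real q * x - of_int p\<bar>"
      by (rule dist_int_attained)
    \<comment> \<open>The first denominator beyond q. Since \<open>Q 0\<close> = 0 and
      \<open>Q 1\<close> = 1 do not exceed q, it has two predecessors, as the error formula
      requires.\<close>
    define k where "k = (LEAST k. int q < Q k)"
    have "int q < Q (Suc (Suc q))" using convergent_den_ge[of "Suc q"] by simp
    then have k: "int q < Q k" unfolding k_def by (rule LeastI)
    have k_min: "Q j \<le> int q" if "j < k" for j
      using not_less_Least that unfolding k_def by fastforce
    have "k \<noteq> 0" using k by (metis convergent_den.simps(1) not_less of_nat_0_le_iff)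
    moreover have "k \<noteq> Suc 0" using k q by (metis convergent_den.simps(2) not_less of_nat_le_iff of_nat_1)
    ultimately obtain m where m: "k = Suc (Suc m)" by (metis not0_implies_Suc)
    let ?d = "\<bar>D (Suc m)\<bar>"
    have "1 = ?d * (of_int (Q (Suc m)) * X (Suc m) + of_int (Q m))"
      by (rule convergent_err_mult[symmetric])
    \<comment> \<open>Both denominators are at most q and the complete quotient is below B + 1,
      whence the constant 1/(B + 2).\<close>
    also have "\<dots> \<le> ?d * (real q * (of_int B + 1) + real q)"
    proof (intro mult_left_mono add_mono mult_mono)
      show "of_int (Q (Suc m)) \<le> real q" "of_int (Q m) \<le> real q"
        using k_min[of "Suc m"] k_min[of m] m by auto
      show "X (Suc m) \<le> of_int B + 1"
        using complete_quotient_less[of "Suc m"] B[of "Suc m"] by simp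
    qed (use complete_quotient_Suc_gt_1[of m] in auto)
    also have "\<dots> = (of_int B + 2) * (real q * ?d)" by (simp add: algebra_simps)
    finally have "1 / (of_int B + 2) \<le> real q * ?d" using B1 by (simp add: field_simps)
    also have "\<dots> \<le> real q * dist_int (real q * x)"
      using convergent_best_approximation[of "int q" "Suc m" p] k m q p
      by (intro mult_left_mono) auto
    finally show ?thesis .
  qed
  then show ?R using B1 by (intro exI[of _ "1 / (of_int B + 2)"]) auto
next
  assume ?R
  then obtain c where c: "c > 0" "\<And>n. n \<ge> 1 \<Longrightarrow> c \<le> real n * dist_int (real n * x)" by blast
  have "a n \<le> \<lfloor>1 / c\<rfloor>" if n: "n \<ge> 1" for n
  proof -
    obtain m where m: "n = Suc m" using n by (cases n) auto
    have Q: "1 \<le> Q n" "0 \<le> Q m" using convergent_den_mono[of m] m by auto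
    define q where "q = nat (Q n)"
    have q: "1 \<le> q" "real q = of_int (Q n)" using Q by (auto simp: q_def)
    have X: "1 < X n" using complete_quotient_Suc_gt_1 m by simp
    have "c * X n \<le> (real q * dist_int (real q * x)) * X n"
      using c(2)[OF q(1)] X by (intro mult_right_mono) auto
    also have "\<dots> \<le> (real q * \<bar>D n\<bar>) * X n"
      using dist_int_le[of "real q * x" "P n"] X q
      by (intro mult_right_mono mult_left_mono) (auto simp: convergent_err_def)
    \<comment> \<open>Adding the nonnegative term with \<open>Q m\<close> completes the error
      formula.\<close>
    also have "\<dots> \<le> \<bar>D n\<bar> * (of_int (Q n) * X n + of_int (Q m))"
      using Q q by (simp add: algebra_simps)
    also have "\<dots> = 1" using convergent_err_mult m by simp
    finally have "X n \<le> 1 / c" using c(1) by (simp add: field_simps)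
    then show ?thesis using partial_quotient_le[of n] by (simp add: le_floor_iff)
  qed
  then show ?L unfolding bounded_partial_quotients_def by blast
qed

end

theorem proposition7p1:
  shows "(\<exists>K::real. K > 0 \<and> (\<forall>\<delta>::real. \<delta> > 0 \<longrightarrow> (\<exists>c::real. c > 0 \<and>
            (AE \<alpha>\<in>{0<..<1} in lebesgue. \<forall>\<^sub>F \<epsilon> in at_right 0.
               c * inverse \<epsilon> * ln (inverse \<epsilon>) powr (- 2 * (1 + \<delta>)) \<le> real (hit_time \<epsilon> \<alpha>) \<and>
               real (hit_time \<epsilon> \<alpha>) \<le> K * inverse \<epsilon>))))
       \<and> (\<forall>\<alpha>::real. \<alpha> \<in> {0<..<1} \<longrightarrow> \<alpha> \<notin> \<rat> \<longrightarrow>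
            (bounded_partial_quotients \<alpha> \<longleftrightarrow>
              (\<exists>c K::real. c > 0 \<and> K > 0 \<and>
                (\<forall>\<^sub>F \<epsilon> in at_right 0.
                   c * inverse \<epsilon> \<le> real (hit_time \<epsilon> \<alpha>) \<and>
                   real (hit_time \<epsilon> \<alpha>) \<le> K * inverse \<epsilon>))))"
proof (rule conjI)
  show "\<exists>K::real. K > 0 \<and> (\<forall>\<delta>::real. \<delta> > 0 \<longrightarrow> (\<exists>c::real. c > 0 \<and>
            (AE \<alpha>\<in>{0<..<1} in lebesgue. \<forall>\<^sub>F \<epsilon> in at_right 0.
               c * inverse \<epsilon> * ln (inverse \<epsilon>) powr (- 2 * (1 + \<delta>)) \<le> real (hit_time \<epsilon> \<alpha>) \<and>
               real (hit_time \<epsilon> \<alpha>) \<le> K * inverse \<epsilon>)))"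
  \<comment> \<open>The constant 2 comes from Dirichlet's theorem and is fixed before
    \<delta>.\<close>
  proof (rule exI[of _ 2], intro conjI allI impI)
    fix \<delta> :: real assume "\<delta> > 0"
    then show "\<exists>c::real. c > 0 \<and> (AE \<alpha>\<in>{0<..<1} in lebesgue. \<forall>\<^sub>F \<epsilon> in at_right 0.
               c * inverse \<epsilon> * ln (inverse \<epsilon>) powr (- 2 * (1 + \<delta>)) \<le> real (hit_time \<epsilon> \<alpha>) \<and>
               real (hit_time \<epsilon> \<alpha>) \<le> 2 * inverse \<epsilon>)"
      by (intro exI[of _ "1/9"] conjI AE_hit_time_bounds) simp
  qed simp
\<comment> \<open>Both sides are equivalent to a positive lower bound on n ||n\<alpha>|| over n
  \<ge> 1.\<close>
qed (intro allI impI, rule trans[OF bounded_partial_quotients_iff_badly_approximable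
    hit_time_bounds_iff_badly_approximable[symmetric]])

end
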